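(* Let $n>2$ be an even integer and $m\ge0$ an integer. Then, as an identity of meromorphic functions of $s\in\mathbb{C}$ (i.e. for all $s$ away from the poles), $$I_m(s)=\frac{(n-1)_m}{(n+s)_m}\;{}_4F_3\!\left(\begin{matrix}m,\ 1-\frac n2,\ n+s,\ s+1\\ m+n+s,\ \frac n2+s+1,\ 2-n\end{matrix};1\right).$$
   Context: $(a)_\ell=a(a+1)\cdots(a+\ell-1)$ is the Pochhammer symbol, $(a)_0=1$. The generalized hypergeometric series is $${}_pF_q\!\left(\begin{matrix}a_1,\dots,a_p\\ b_1,\dots,b_q\end{matrix};z\right)=\sum_{\ell\ge0}\frac{(a_1)_\ell\cdots(a_p)_\ell}{(b_1)_\ell\cdots(b_q)_\ell}\frac{z^\ell}{\ell!}.$$ If a numerator parameter is a non-positive integer $-N$ and a denominator parameter is a negative integer $-M$ with $N<M$, the symbol denotes the finite sum over $0\le\ell\le N$; so here the sum runs over $0\le \ell\le\frac n2-1$. For integers $n>2$ and $m\ge0$ put $$S_m(t)=\frac{(n-1)_m}{(\frac n2)_m}\,{}_2F_1\!\left(\begin{matrix}m,\ 1-\frac n2\\ m+\frac n2\end{matrix};t\right),$$ and for $s>-1$ (or $\operatorname{Re}s>-1$) $$I_m(s)=\frac{\Gamma(\frac n2+s+1)}{\Gamma(\frac n2)\,\Gamma(s+1)}\int_0^1t^{m+\frac n2-1}(1-t)^sS_m(t)^2\,dt.$$ The function $I_m$ extends to a meromorphic function on $\mathbb{C}$, still denoted $I_m(s)$. *)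

theory Defs
  imports "HOL-Complex_Analysis.Complex_Analysis"
begin

text \<open>
  The value at \<open>z\<close> of the generalized hypergeometric series with numerator parameters \<open>as\<close> and
  denominator parameters \<open>bs\<close>.  Since \<open>x / 0 = 0\<close>, a numerator parameter \<open>-N\<close> together with a
  denominator parameter \<open>-M\<close>, where \<open>N < M\<close>, gives the finite sum over \<open>0 \<le> l \<le> N\<close>: all later
  terms have numerator \<open>0\<close>.
\<close>
definition hypergeo :: "'a list \<Rightarrow> 'a list \<Rightarrow> 'a \<Rightarrow> 'a :: {banach, real_normed_field}" where
  "hypergeo as bs z = eval_fps (fps_hypergeo as bs 1) z"

lemma hypergeo_altdef:
  "hypergeo as bs z =
     (\<Sum>l. (\<Prod>a\<leftarrow>as. pochhammer a l) / (\<Prod>b\<leftarrow>bs. pochhammer b l) * z ^ l / fact l)"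
proof -
  have *: "foldl (\<lambda>r a. r * pochhammer a l) c xs = c * (\<Prod>a\<leftarrow>xs. pochhammer a l)"
    for c :: 'a and xs l
    by (induction xs arbitrary: c) (simp_all add: mult.assoc)
  show ?thesis
    by (simp add: hypergeo_def eval_fps_def *)
qed

definition S_fun :: "nat \<Rightarrow> nat \<Rightarrow> real \<Rightarrow> real" where
  "S_fun n m t = pochhammer (real n - 1) m / pochhammer (real n / 2) m *
     hypergeo [real m, 1 - real n / 2] [real m + real n / 2] t"

definition I_integral :: "nat \<Rightarrow> nat \<Rightarrow> complex \<Rightarrow> complex" where
  "I_integral n m s =
     Gamma (of_nat n / 2 + s + 1) / (Gamma (of_nat n / 2) * Gamma (s + 1)) *
     integral {0..1} (\<lambda>t. of_real (t powr (real m + real n / 2 - 1)) *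
                          of_real (1 - t) powr s * of_real ((S_fun n m t)\<^sup>2))"

text \<open>
  Requiring the continuation to be \<^emph>\<open>nicely\<close> meromorphic fixes its values at the isolated
  singularities (\<open>0\<close> at poles, the limit elsewhere), so that it is unique as a function.
\<close>
definition is_I_continuation :: "nat \<Rightarrow> nat \<Rightarrow> (complex \<Rightarrow> complex) \<Rightarrow> bool" where
  "is_I_continuation n m F \<longleftrightarrow>
     F nicely_meromorphic_on UNIV \<and> (\<forall>s. Re s > -1 \<longrightarrow> F s = I_integral n m s)"

definition I_mero :: "nat \<Rightarrow> nat \<Rightarrow> complex \<Rightarrow> complex" where
  "I_mero n m = (THE F. is_I_continuation n m F)"

end

theory Submission
  imports Defs
begin

text \<open>
  Write \<open>n = 2q + 2\<close>.  Re-expanding the terminating series of \<open>S\<^sub>m(t)\<close> in powers of \<open>1 - t\<close> gives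
  a series with denominator parameter \<open>2 - n = -2q\<close>, and all constants cancel.  Use this
  expansion for one factor of \<open>S\<^sub>m(t)\<^sup>2\<close> and the expansion at \<open>0\<close> for the other.  The remaining
  integrals of \<open>t\<^bsup>m+q\<^esup> (1 - t)\<^bsup>s+l\<^esup> S\<^sub>m(t)\<close> are single sums of Beta values, which the
  Chu-Vandermonde identity puts in closed form, so that the sum over \<open>l\<close> is the asserted \<open>\<^sub>4F\<^sub>3\<close>.
\<close>

section \<open>Terminating hypergeometric sums\<close>

text \<open>Past \<open>N\<close> the numerator contains the factor 0, and the quotient is 0 even
  where the denominator vanishes too, as it eventually does for the parameter
  \<open>2 - n\<close>.\<close>

lemma hypergeo_terminating:
  fixes z :: "'a :: {banach, real_normed_field}"
  assumes "- of_nat N \<in> set as"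
  shows "hypergeo as bs z =
    (\<Sum>l\<le>N. (\<Prod>a\<leftarrow>as. pochhammer a l) / (\<Prod>b\<leftarrow>bs. pochhammer b l) * z ^ l / fact l)"
  unfolding hypergeo_altdef
proof (rule suminf_finite)
  fix l assume "l \<notin> {..N}"
  then have "pochhammer (- of_nat N :: 'a) l = 0"
    by (auto intro: pochhammer_of_nat_eq_0_lemma)
  then have "(\<Prod>a\<leftarrow>as. pochhammer a l) = 0"
    using assms by (force simp: prod_list_zero_iff)
  then show "(\<Prod>a\<leftarrow>as. pochhammer a l) / (\<Prod>b\<leftarrow>bs. pochhammer b l) * z ^ l / fact l = 0"
    by simp
qed simp

text \<open>The Chu-Vandermonde identity; \<open>pochhammer c N \<noteq> 0\<close> packs the
  condition that none of \<open>c, ..., c + N - 1\<close> is 0.\<close>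

lemma hypergeo_2_1_at_1:
  fixes a c :: "'a :: {banach, real_normed_field}"
  assumes "pochhammer c N \<noteq> 0"
  shows "(\<Sum>k\<le>N. pochhammer a k * pochhammer (- of_nat N) k / (pochhammer c k * fact k)) =
    pochhammer (c - a) N / pochhammer c N"
  using Vandermonde_pochhammer[of N c a] assms
  by (simp add: pochhammer_eq_0_iff atLeast0AtMost mult.commute)

text \<open>Up to sign, the factors of \<open>pochhammer (1 - b - of_nat N) l\<close> are the last
  \<open>l\<close> factors of \<open>pochhammer b N\<close> in reverse order.\<close>

lemma pochhammer_diff_reflect:
  fixes b :: "'a :: field_char_0"
  assumes "l \<le> N"
  shows "pochhammer b (N - l) * pochhammer (1 - b - of_nat N) l = (- 1) ^ l * pochhammer b N"
proof -
  have "pochhammer (1 - b - of_nat N) l = (- 1) ^ l * pochhammer (b + of_nat (N - l)) l"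
    using pochhammer_minus[of "b + of_nat N - 1" l] assms by (simp add: algebra_simps of_nat_diff)
  moreover have "pochhammer b N = pochhammer b (N - l) * pochhammer (b + of_nat (N - l)) l"
    using pochhammer_product'[of b "N - l" l] assms by simp
  ultimately show ?thesis by simp
qed

text \<open>Expand \<open>t ^ k\<close> as \<open>((t - 1) + 1) ^ k\<close> and exchange the sums:
  the coefficient of \<open>(1 - t) ^ l\<close> is again a terminating sum at argument 1.\<close>

lemma hypergeo_2_1_connection:
  fixes a c t :: "'a :: {banach, real_normed_field}"
  assumes c: "pochhammer c N \<noteq> 0" and ca: "pochhammer (c - a) N \<noteq> 0"
  shows "(\<Sum>k\<le>N. pochhammer a k * pochhammer (- of_nat N) k / (pochhammer c k * fact k) * t ^ k) =
    pochhammer (c - a) N / pochhammer c N *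
    (\<Sum>l\<le>N. pochhammer a l * pochhammer (- of_nat N) l /
      (pochhammer (1 - (c - a) - of_nat N) l * fact l) * (1 - t) ^ l)"
proof -
  define u where "u k = pochhammer a k * pochhammer (- of_nat N) k / (pochhammer c k * fact k)" for k
  have c0: "pochhammer c k \<noteq> 0" if "k \<le> N" for k
    using c that pochhammer_neq_0_mono by blast
  have inner: "(\<Sum>k=l..N. u k * of_nat (k choose l)) * (- 1) ^ l =
    pochhammer (c - a) N / pochhammer c N * (pochhammer a l * pochhammer (- of_nat N) l /
      (pochhammer (1 - (c - a) - of_nat N) l * fact l))" if l: "l \<le> N" for l
  proof -
    let ?c = "pochhammer a l * pochhammer (- of_nat N) l / (pochhammer c l * fact l)"
    have cl: "pochhammer c N = pochhammer c l * pochhammer (c + of_nat l) (N - l)"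
      using pochhammer_product'[of c l "N - l"] l by simp
    \<comment> \<open>With \<open>k = j + l\<close> each Pochhammer symbol splits after
      \<open>l\<close> factors, leaving a Chu-Vandermonde sum with parameters \<open>a + l\<close>,
      \<open>c + l\<close> and \<open>- (N - l)\<close>; the difference \<open>c - a\<close> is
      unchanged.\<close>
    have "(\<Sum>k=l..N. u k * of_nat (k choose l)) = (\<Sum>j\<le>N - l. u (j + l) * of_nat ((j + l) choose l))"
      by (rule sum.reindex_bij_witness[of _ "\<lambda>j. j + l" "\<lambda>k. k - l"]) (use l in auto)
    also have "\<dots> = (\<Sum>j\<le>N - l. ?c * (pochhammer (a + of_nat l) j * pochhammer (- of_nat (N - l)) j /
        (pochhammer (c + of_nat l) j * fact j)))"
    proof (rule sum.cong)
      fix j assume "j \<in> {..N - l}"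
      then have "of_nat ((j + l) choose l) = (fact (j + l) / (fact l * fact j) :: 'a)"
        using binomial_fact[of l "j + l", where 'a = 'a] by simp
      moreover have "- of_nat N + of_nat l = (- of_nat (N - l) :: 'a)"
        using l by (simp add: of_nat_diff)
      ultimately show "u (j + l) * of_nat ((j + l) choose l) =
          ?c * (pochhammer (a + of_nat l) j * pochhammer (- of_nat (N - l)) j /
          (pochhammer (c + of_nat l) j * fact j))"
        unfolding u_def add.commute[of j l] pochhammer_product' by (simp add: mult_ac)
    qed simp
    also have "\<dots> = ?c * (pochhammer (c - a) (N - l) / pochhammer (c + of_nat l) (N - l))"
      using hypergeo_2_1_at_1[of "c + of_nat l" "N - l" "a + of_nat l"] c cl
      unfolding sum_distrib_left[symmetric] by simp
    also have "\<dots> = pochhammer a l * pochhammer (- of_nat N) l / fact l *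
        pochhammer (c - a) (N - l) / pochhammer c N"
      by (simp add: cl)
    finally have 1: "(\<Sum>k=l..N. u k * of_nat (k choose l)) = \<dots>" .
    \<comment> \<open>Reflection with \<open>b = c - a\<close> trades the length
      \<open>N - l\<close> for the denominator parameter \<open>1 - (c - a) - N\<close>;
      \<open>ca\<close> keeps that denominator away from 0.\<close>
    have 2: "pochhammer (c - a) (N - l) * pochhammer (1 - (c - a) - of_nat N) l =
      (- 1) ^ l * pochhammer (c - a) N"
      by (rule pochhammer_diff_reflect[OF l])
    then have "pochhammer (1 - (c - a) - of_nat N) l \<noteq> 0"
      using ca by auto
    with 2 have 3: "(- 1) ^ l * pochhammer (c - a) (N - l) =
      pochhammer (c - a) N / pochhammer (1 - (c - a) - of_nat N) l"
      by (simp add: field_simps flip: mult.assoc power_mult_distrib)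
    have "(\<Sum>k=l..N. u k * of_nat (k choose l)) * (- 1) ^ l =
        pochhammer a l * pochhammer (- of_nat N) l / fact l *
        ((- 1) ^ l * pochhammer (c - a) (N - l)) / pochhammer c N"
      unfolding 1 by simp
    also have "\<dots> = pochhammer (c - a) N / pochhammer c N * (pochhammer a l * pochhammer (- of_nat N) l /
      (pochhammer (1 - (c - a) - of_nat N) l * fact l))"
      unfolding 3 by (simp add: mult_ac)
    finally show ?thesis .
  qed
  have "(\<Sum>k\<le>N. u k * t ^ k) = (\<Sum>k\<le>N. u k * (\<Sum>l\<le>k. of_nat (k choose l) * (- 1) ^ l * (1 - t) ^ l))"
  proof (rule sum.cong)
    fix k
    have "(t - 1) ^ l = (- 1) ^ l * (1 - t) ^ l" for l
      by (simp flip: power_mult_distrib)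
    then show "u k * t ^ k = u k * (\<Sum>l\<le>k. of_nat (k choose l) * (- 1) ^ l * (1 - t) ^ l)"
      using binomial_ring[of "t - 1" 1 k] by (simp add: mult.assoc)
  qed simp
  also have "\<dots> = (\<Sum>k\<le>N. \<Sum>l\<le>k. u k * of_nat (k choose l) * (- 1) ^ l * (1 - t) ^ l)"
    by (simp add: sum_distrib_left mult.assoc)
  also have "\<dots> = (\<Sum>l\<le>N. \<Sum>k=l..N. u k * of_nat (k choose l) * (- 1) ^ l * (1 - t) ^ l)"
    by (subst (1 2) sum.Sigma)
      (auto intro!: sum.reindex_bij_witness[of _ "\<lambda>(l, k). (k, l)" "\<lambda>(k, l). (l, k)"])
  also have "\<dots> = (\<Sum>l\<le>N. (\<Sum>k=l..N. u k * of_nat (k choose l)) * (- 1) ^ l * (1 - t) ^ l)"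
    by (simp add: sum_distrib_right)
  finally show ?thesis
    unfolding u_def[symmetric] using inner by (simp add: sum_distrib_left mult.assoc)
qed

section \<open>A Beta integral with one integer exponent\<close>

text \<open>Integration by parts lowers \<open>i\<close> and raises \<open>z\<close> by 1, so the
  induction is over all \<open>z\<close>. The integrand may be unbounded at 1, but the
  antiderivative is continuous there because \<open>Re (z + 1) > 0\<close>.\<close>

lemma has_integral_Beta_complex_nat:
  fixes z :: complex
  assumes "Re z > -1"
  shows "((\<lambda>t. of_real t ^ i * of_real (1 - t) powr z) has_integral
    fact i / pochhammer (z + 1) (Suc i)) {0..1}"
  using assms
proof (induction i arbitrary: z)
  case (0 z)
  then have z: "z + 1 \<noteq> 0" "Re (z + 1) > 0"
    by (auto simp: complex_eq_iff)
  let ?F = "\<lambda>t::real. - (of_real (1 - t) powr (z + 1) / (z + 1))"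
  have "((\<lambda>t. of_real (1 - t) powr z) has_integral (?F 1 - ?F 0)) {0..1}"
  proof (rule fundamental_theorem_of_calculus_interior)
    show "continuous_on {0..1} ?F"
      using z by (auto intro!: continuous_intros)
    show "(?F has_vector_derivative of_real (1 - t) powr z) (at t)" if "t \<in> {0<..<1}" for t
      using that z
      by (auto intro!: derivative_eq_intros has_vector_derivative_real_field simp: complex_nonpos_Reals_iff)
  qed simp
  then show ?case using z by simp
next
  case (Suc i z)
  then have z: "z + 1 \<noteq> 0" "Re (z + 1) > 0"
    by (auto simp: complex_eq_iff)
  let ?F = "\<lambda>t::real. - (of_real t ^ Suc i * of_real (1 - t) powr (z + 1) / (z + 1))"
  let ?g = "\<lambda>t::real. of_real t ^ i * of_real (1 - t) powr (z + 1)"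
  \<comment> \<open>By the product rule \<open>?F\<close> is an antiderivative of the wanted
    integrand minus a multiple of \<open>?g\<close>, and it vanishes at both end points.\<close>
  have "((\<lambda>t. of_real t ^ Suc i * of_real (1 - t) powr z - of_nat (Suc i) / (z + 1) * ?g t)
    has_integral (?F 1 - ?F 0)) {0..1}"
  proof (rule fundamental_theorem_of_calculus_interior)
    show "continuous_on {0..1} ?F"
      using z by (auto intro!: continuous_intros)
    show "(?F has_vector_derivative
        of_real t ^ Suc i * of_real (1 - t) powr z - of_nat (Suc i) / (z + 1) * ?g t) (at t)"
      if "t \<in> {0<..<1}" for t
    proof -
      let ?t = "of_real t :: complex"
      have 1: "((\<lambda>x. x ^ Suc i) has_field_derivative of_nat (Suc i) * ?t ^ i) (at ?t)"
        by (rule DERIV_cong, rule DERIV_power[OF DERIV_ident]) simp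
      have 2: "((\<lambda>x. (1 - x) powr (z + 1)) has_field_derivative - ((z + 1) * (1 - ?t) powr z)) (at ?t)"
        using that by (auto intro!: derivative_eq_intros simp: complex_nonpos_Reals_iff)
      have "((\<lambda>x. - (x ^ Suc i * (1 - x) powr (z + 1) / (z + 1))) has_field_derivative
        ?t ^ Suc i * of_real (1 - t) powr z - of_nat (Suc i) / (z + 1) * ?g t) (at ?t)"
        by (rule DERIV_cong[OF DERIV_minus[OF DERIV_cdivide[OF DERIV_mult[OF 1 2]]]])
          (use z in \<open>simp add: divide_simps algebra_simps\<close>)
      from has_vector_derivative_real_field[OF this] show ?thesis
        by simp
    qed
  qed simp
  moreover have "(?g has_integral fact i / pochhammer (z + 1 + 1) (Suc i)) {0..1}"
    using z by (intro Suc.IH) auto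
  ultimately have "((\<lambda>t. (of_real t ^ Suc i * of_real (1 - t) powr z - of_nat (Suc i) / (z + 1) * ?g t) +
    of_nat (Suc i) / (z + 1) * ?g t) has_integral
    (?F 1 - ?F 0) + of_nat (Suc i) / (z + 1) * (fact i / pochhammer (z + 1 + 1) (Suc i))) {0..1}"
    by (intro has_integral_add has_integral_mult_right)
  then show ?case
    using z by (simp add: pochhammer_rec[of "z + 1" "Suc i"])
qed


section \<open>Expansions and moments of \<open>S_fun\<close>\<close>

lemma pochhammer_of_nat_nonzero:
  "x > 0 \<Longrightarrow> pochhammer (of_nat x :: 'a :: field_char_0) k \<noteq> 0"
  by (metis pochhammer_of_nat pochhammer_pos of_nat_eq_0_iff less_irrefl)

lemma pochhammer_nonzero_Re:
  "Re z > 0 \<Longrightarrow> pochhammer z k \<noteq> 0"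
  by (auto simp: pochhammer_eq_0_iff)

lemma S_fun_eq:
  "S_fun (2 * q + 2) m t = pochhammer (2 * real q + 1) m / pochhammer (real q + 1) m *
    (\<Sum>k\<le>q. pochhammer (real m) k * pochhammer (- real q) k /
      (pochhammer (real m + real q + 1) k * fact k) * t ^ k)"
  using hypergeo_terminating[of q "[real m, - real q]" "[real m + real q + 1]" t]
  by (simp add: S_fun_def add_divide_distrib diff_divide_distrib algebra_simps)

text \<open>The connection formula with \<open>a = m\<close> and \<open>c = m + q + 1\<close>: then
  \<open>c - a = q + 1\<close>, and the new denominator parameter is \<open>- 2 * q\<close>, which
  is \<open>2 - n\<close>.\<close>

lemma S_fun_expansion_at_1:
  "S_fun (2 * q + 2) m t =
    (\<Sum>l\<le>q. pochhammer (real m) l * pochhammer (- real q) l /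
      (pochhammer (- 2 * real q) l * fact l) * (1 - t) ^ l)"
proof -
  have nz: "pochhammer (real (Suc x)) k \<noteq> 0" for x k
    by (rule pochhammer_of_nat_nonzero) simp
  have 1: "pochhammer (real m + real q + 1) q \<noteq> 0" "pochhammer (real q + 1) q \<noteq> 0"
    "pochhammer (real q + 1) m \<noteq> 0"
    using nz[of "m + q" q] nz[of q q] nz[of q m] by (simp_all add: add_ac)
  \<comment> \<open>Both sides are \<open>pochhammer (real q + 1) (m + q)\<close>, split after
    \<open>m\<close> and after \<open>q\<close> factors; hence the normalisation of
    \<open>S_fun\<close> cancels the connection constant.\<close>
  have "pochhammer (real q + 1) m * pochhammer (real m + real q + 1) q =
      pochhammer (real q + 1) q * pochhammer (2 * real q + 1) m"
    using pochhammer_product'[of "real q + 1" m q] pochhammer_product'[of "real q + 1" q m]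
    by (simp add: add_ac)
  then have *: "pochhammer (2 * real q + 1) m / pochhammer (real q + 1) m *
    (pochhammer (real q + 1) q / pochhammer (real m + real q + 1) q) = 1"
    using 1 nz[of "2 * q" m] by (simp add: field_simps)
  have c: "real m + real q + 1 - real m = real q + 1" "1 - (real q + 1) - real q = - 2 * real q"
    by simp_all
  have "pochhammer (real m + real q + 1 - real m) q \<noteq> 0"
    unfolding c(1) by (rule 1)
  note connection = hypergeo_2_1_connection[OF 1(1) this, of t, unfolded c]
  show ?thesis
    unfolding S_fun_eq connection mult.assoc[symmetric] * by simp
qed

text \<open>Integrate the expansion at 0 termwise. The weight \<open>t ^ (m + q)\<close> produces
  \<open>fact (m + q + k)\<close>, which absorbs the denominator symbol of the \<open>k\<close>-th
  coefficient, so that a Chu-Vandermonde sum remains.\<close>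

lemma has_integral_S_fun_moment:
  fixes z :: complex
  assumes z: "Re z > -1"
  shows "((\<lambda>t. of_real t ^ (m + q) * of_real (1 - t) powr z * of_real (S_fun (2 * q + 2) m t))
    has_integral pochhammer (2 * of_nat q + 1) m * fact q /
      (pochhammer (z + 1) (Suc q) * pochhammer (z + 2 * of_nat q + 2) m)) {0..1}"
proof -
  define C :: complex where "C = pochhammer (2 * of_nat q + 1) m / pochhammer (of_nat q + 1) m"
  define u :: "nat \<Rightarrow> complex" where "u k = pochhammer (of_nat m) k * pochhammer (- of_nat q) k /
    (pochhammer (of_nat m + of_nat q + 1) k * fact k)" for k
  have S: "of_real (S_fun (2 * q + 2) m t) = C * (\<Sum>k\<le>q. u k * of_real t ^ k)" for t
    unfolding S_fun_eq by (simp add: C_def u_def pochhammer_of_real[symmetric])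
  have nz: "pochhammer (of_nat (Suc x) :: complex) k \<noteq> 0" for x k
    by (rule pochhammer_of_nat_nonzero) simp
  have nz1: "pochhammer (of_nat m + of_nat q + 1 :: complex) k \<noteq> 0"
    "pochhammer (of_nat q + 1 :: complex) m \<noteq> 0" for k
    using nz[of "m + q" k] nz[of q m] by (simp_all add: add_ac)
  have nz2: "pochhammer (z + 1) k \<noteq> 0" "pochhammer (z + of_nat m + of_nat q + 2) k \<noteq> 0"
    "pochhammer (z + of_nat q + 2) k \<noteq> 0" "pochhammer (z + 2 * of_nat q + 2) k \<noteq> 0" for k
    by (rule pochhammer_nonzero_Re; use z in simp)+
  have fact_mq: "fact (m + q) = fact q * pochhammer (of_nat q + 1 :: complex) m"
    using pochhammer_product'[of "1 :: complex" q m] by (simp add: pochhammer_fact add_ac)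
  have "((\<lambda>t. \<Sum>k\<le>q. C * u k * (of_real t ^ (m + q + k) * of_real (1 - t) powr z)) has_integral
    (\<Sum>k\<le>q. C * u k * (fact (m + q + k) / pochhammer (z + 1) (Suc (m + q + k))))) {0..1}"
    by (intro has_integral_sum has_integral_mult_right has_integral_Beta_complex_nat z) simp
  moreover have "(\<Sum>k\<le>q. C * u k * (fact (m + q + k) / pochhammer (z + 1) (Suc (m + q + k)))) =
    C * fact (m + q) / pochhammer (z + 1) (Suc (m + q)) *
    (\<Sum>k\<le>q. pochhammer (of_nat m) k * pochhammer (- of_nat q) k /
      (pochhammer (z + of_nat m + of_nat q + 2) k * fact k))"
    unfolding sum_distrib_left
  proof (rule sum.cong)
    fix k
    have "fact (m + q + k) = fact (m + q) * pochhammer (of_nat m + of_nat q + 1 :: complex) k"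
      using pochhammer_product'[of "1 :: complex" "m + q" k] by (simp add: pochhammer_fact add_ac)
    moreover have "pochhammer (z + 1) (Suc (m + q + k)) =
        pochhammer (z + 1) (Suc (m + q)) * pochhammer (z + of_nat m + of_nat q + 2) k"
      using pochhammer_product'[of "z + 1" "Suc (m + q)" k] by (simp add: add_ac)
    ultimately show "C * u k * (fact (m + q + k) / pochhammer (z + 1) (Suc (m + q + k))) =
      C * fact (m + q) / pochhammer (z + 1) (Suc (m + q)) *
      (pochhammer (of_nat m) k * pochhammer (- of_nat q) k /
      (pochhammer (z + of_nat m + of_nat q + 2) k * fact k))"
      using nz1 by (simp only: u_def) (simp add: mult_ac)
  qed simp
  also have "(\<Sum>k\<le>q. pochhammer (of_nat m) k * pochhammer (- of_nat q) k /
      (pochhammer (z + of_nat m + of_nat q + 2) k * fact k)) =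
    pochhammer (z + of_nat q + 2) q / pochhammer (z + of_nat m + of_nat q + 2) q"
    using hypergeo_2_1_at_1[OF nz2(2)[of q], of "of_nat m"]
    by (simp add: add_ac add_diff_eq)
  also have "C * fact (m + q) / pochhammer (z + 1) (Suc (m + q)) * \<dots> =
    pochhammer (2 * of_nat q + 1) m * fact q /
      (pochhammer (z + 1) (Suc q) * pochhammer (z + 2 * of_nat q + 2) m)"
  proof -
    \<comment> \<open>Both sides are \<open>pochhammer (z + 1) (m + 2 * q + 1)\<close>, cut in
      different places.\<close>
    have "pochhammer (z + 1) (Suc (m + q)) * pochhammer (z + of_nat m + of_nat q + 2) q =
      pochhammer (z + 1) (Suc q) * (pochhammer (z + of_nat q + 2) q * pochhammer (z + 2 * of_nat q + 2) m)"
      using pochhammer_product'[of "z + 1" "Suc (m + q)" q] pochhammer_product'[of "z + 1" "Suc q" "q + m"]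
        pochhammer_product'[of "z + of_nat q + 2" q m]
      by (simp add: add_ac)
    moreover have "C * fact (m + q) = pochhammer (2 * of_nat q + 1) m * fact q"
      using nz1 by (simp add: C_def fact_mq)
    ultimately show ?thesis
      using nz2(3)[of q] by (simp only: times_divide_times_eq) simp
  qed
  finally show ?thesis
    unfolding S by (simp add: sum_distrib_left sum_distrib_right power_add mult_ac)
qed


section \<open>Closed form of the integral for \<open>Re s > -1\<close>\<close>

text \<open>The factor \<open>(1 - t) ^ l\<close> of the expansion at 1 shifts \<open>s\<close> to
  \<open>s + l\<close>, so each term is a moment \<open>P (s + l)\<close>; the Gamma quotient equals
  \<open>pochhammer (s + 1) (Suc q) / fact q\<close>.\<close>

lemma I_integral_eq:
  fixes s :: complex
  assumes s: "Re s > -1"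
  shows "I_integral (2 * q + 2) m s =
    pochhammer (2 * of_nat q + 1) m / pochhammer (2 * of_nat q + 2 + s) m *
    (\<Sum>l\<le>q. pochhammer (of_nat m) l * pochhammer (- of_nat q) l *
        pochhammer (2 * of_nat q + 2 + s) l * pochhammer (s + 1) l /
      (pochhammer (of_nat m + 2 * of_nat q + 2 + s) l * pochhammer (of_nat q + 2 + s) l *
        pochhammer (- 2 * of_nat q) l * fact l))"
proof -
  define \<beta> :: "nat \<Rightarrow> complex" where "\<beta> l = pochhammer (of_nat m) l * pochhammer (- of_nat q) l /
    (pochhammer (- 2 * of_nat q) l * fact l)" for l
  define P where "P z = pochhammer (2 * of_nat q + 1) m * fact q /
      (pochhammer (z + 1) (Suc q) * pochhammer (z + 2 * of_nat q + 2) m)" for z :: complex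
  let ?S = "S_fun (2 * q + 2) m"
  have S: "of_real (?S t) = (\<Sum>l\<le>q. \<beta> l * of_real (1 - t) ^ l)" for t
    unfolding S_fun_expansion_at_1 by (simp add: \<beta>_def pochhammer_of_real[symmetric])
  have "((\<lambda>t. \<Sum>l\<le>q. \<beta> l * (of_real t ^ (m + q) * of_real (1 - t) powr (s + of_nat l) * of_real (?S t)))
    has_integral (\<Sum>l\<le>q. \<beta> l * P (s + of_nat l))) {0..1}"
    unfolding P_def using s
    by (intro has_integral_sum has_integral_mult_right has_integral_S_fun_moment) auto
  then have "((\<lambda>t. of_real (t powr (real m + real (2 * q + 2) / 2 - 1)) *
      of_real (1 - t) powr s * of_real ((?S t)\<^sup>2))
    has_integral (\<Sum>l\<le>q. \<beta> l * P (s + of_nat l))) {0..1}"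
  \<comment> \<open>The integrands are compared in the open interval only:
    \<open>0 powr 0 = 0\<close>, but \<open>0 ^ 0 = 1\<close>.\<close>
  proof (rule has_integral_spike_interior[of _ _ 0 "1 :: real", unfolded box_real])
    fix t :: real assume t: "t \<in> {0<..<1}"
    have 1: "of_real (1 - t) powr (s + of_nat l) = of_real (1 - t) powr s * of_real (1 - t) ^ l" for l
      using t by (simp add: powr_add powr_nat')
    have 2: "t powr (real m + real (2 * q + 2) / 2 - 1) = t ^ (m + q)"
      using t by (simp add: powr_realpow[symmetric] add_divide_distrib)
    show "of_real (t powr (real m + real (2 * q + 2) / 2 - 1)) *
        of_real (1 - t) powr s * of_real ((?S t)\<^sup>2) =
      (\<Sum>l\<le>q. \<beta> l * (of_real t ^ (m + q) * of_real (1 - t) powr (s + of_nat l) * of_real (?S t)))"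
      unfolding 1 2 of_real_power power2_eq_square of_real_mult
      \<comment> \<open>A single factor of the square is expanded; the other stays for the moment
        formula.\<close>
      by (subst (1) S) (simp add: sum_distrib_left sum_distrib_right mult_ac)
  qed
  then have I: "I_integral (2 * q + 2) m s = Gamma (of_nat (2 * q + 2) / 2 + s + 1) /
      (Gamma (of_nat (2 * q + 2) / 2) * Gamma (s + 1)) * (\<Sum>l\<le>q. \<beta> l * P (s + of_nat l))"
    unfolding I_integral_def by (simp only: integral_unique)
  have half: "of_nat (2 * q + 2) / 2 = (of_nat (Suc q) :: complex)"
    by (simp add: add_divide_distrib)
  have "s + 1 \<notin> \<int>\<^sub>\<le>\<^sub>0"
    using s by (auto elim!: nonpos_Ints_cases simp: complex_eq_iff)
  then have "Gamma (of_nat (Suc q) + s + 1) / Gamma (s + 1) = pochhammer (s + 1) (Suc q)"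
    using pochhammer_Gamma[of "s + 1" "Suc q"] by (simp add: add_ac)
  then have G: "Gamma (of_nat (2 * q + 2) / 2 + s + 1) / (Gamma (of_nat (2 * q + 2) / 2) * Gamma (s + 1)) =
      pochhammer (s + 1) (Suc q) / fact q"
    unfolding half using Gamma_fact[of q, where 'a = complex] by (simp add: field_simps)
  have "I_integral (2 * q + 2) m s =
      (\<Sum>l\<le>q. pochhammer (s + 1) (Suc q) / fact q * (\<beta> l * P (s + of_nat l)))"
    unfolding I G by (simp only: sum_distrib_left)
  also have "\<dots> = (\<Sum>l\<le>q. pochhammer (2 * of_nat q + 1) m / pochhammer (2 * of_nat q + 2 + s) m *
     (pochhammer (of_nat m) l * pochhammer (- of_nat q) l *
        pochhammer (2 * of_nat q + 2 + s) l * pochhammer (s + 1) l /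
      (pochhammer (of_nat m + 2 * of_nat q + 2 + s) l * pochhammer (of_nat q + 2 + s) l *
        pochhammer (- 2 * of_nat q) l * fact l)))"
  proof (rule sum.cong)
    fix l
    have nz: "pochhammer (s + of_nat l + 1) (Suc q) \<noteq> 0" "pochhammer (of_nat q + 2 + s) l \<noteq> 0"
      "pochhammer (2 * of_nat q + 2 + s) m \<noteq> 0" "pochhammer (s + of_nat l + 2 * of_nat q + 2) m \<noteq> 0"
      "pochhammer (of_nat m + 2 * of_nat q + 2 + s) l \<noteq> 0"
      "pochhammer (2 * of_nat q + 2 + s) l \<noteq> 0"
      by (rule pochhammer_nonzero_Re; use s in simp)+
    \<comment> \<open>Cutting \<open>pochhammer (s + 1) (Suc q + l)\<close> and
      \<open>pochhammer (2 * q + 2 + s) (m + l)\<close> in two ways each trades symbols with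
      \<open>l\<close> in the argument for symbols of length \<open>l\<close>, as the series
      requires.\<close>
    have 1: "pochhammer (s + 1) (Suc q) * pochhammer (of_nat q + 2 + s) l =
        pochhammer (s + 1) l * pochhammer (s + of_nat l + 1) (Suc q)"
      using pochhammer_product'[of "s + 1" "Suc q" l] pochhammer_product'[of "s + 1" l "Suc q"]
      by (simp add: add_ac)
    have 2: "pochhammer (2 * of_nat q + 2 + s) m * pochhammer (of_nat m + 2 * of_nat q + 2 + s) l =
        pochhammer (2 * of_nat q + 2 + s) l * pochhammer (s + of_nat l + 2 * of_nat q + 2) m"
      using pochhammer_product'[of "2 * of_nat q + 2 + s" m l] pochhammer_product'[of "2 * of_nat q + 2 + s" l m]
      by (simp add: add_ac)
    have 3: "pochhammer (s + 1) (Suc q) / pochhammer (s + of_nat l + 1) (Suc q) =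
        pochhammer (s + 1) l / pochhammer (of_nat q + 2 + s) l"
      using 1 by (simp only: frac_eq_eq[OF nz(1,2)])
    have 4: "1 / pochhammer (s + of_nat l + 2 * of_nat q + 2) m = pochhammer (2 * of_nat q + 2 + s) l /
        (pochhammer (2 * of_nat q + 2 + s) m * pochhammer (of_nat m + 2 * of_nat q + 2 + s) l)"
      unfolding 2 using nz by (simp add: field_simps)
    have "pochhammer (s + 1) (Suc q) / fact q * (\<beta> l * P (s + of_nat l)) =
      \<beta> l * pochhammer (2 * of_nat q + 1) m *
      (pochhammer (s + 1) (Suc q) / pochhammer (s + of_nat l + 1) (Suc q)) *
      (1 / pochhammer (s + of_nat l + 2 * of_nat q + 2) m)"
      by (simp add: P_def mult_ac)
    also have "\<dots> = pochhammer (2 * of_nat q + 1) m / pochhammer (2 * of_nat q + 2 + s) m *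
     (pochhammer (of_nat m) l * pochhammer (- of_nat q) l *
        pochhammer (2 * of_nat q + 2 + s) l * pochhammer (s + 1) l /
      (pochhammer (of_nat m + 2 * of_nat q + 2 + s) l * pochhammer (of_nat q + 2 + s) l *
        pochhammer (- 2 * of_nat q) l * fact l))"
      unfolding 3 4 \<beta>_def by (simp add: mult_ac)
    finally show "pochhammer (s + 1) (Suc q) / fact q * (\<beta> l * P (s + of_nat l)) = \<dots>" .
  qed simp
  finally show ?thesis
    by (simp only: sum_distrib_left)
qed

section \<open>Uniqueness of the meromorphic continuation\<close>

lemma remove_sings_nicely_meromorphic_eq:
  assumes "F nicely_meromorphic_on A" "z \<in> A"
  shows "remove_sings F z = F z"
  using assms by (auto simp: nicely_meromorphic_on_def)

text \<open>The identity theorem on the connected set \<open>UNIV\<close>; niceness upgrades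
  agreement off isolated points to equality everywhere.\<close>

lemma nicely_meromorphic_on_UNIV_unique:
  assumes F: "F nicely_meromorphic_on UNIV" and G: "G nicely_meromorphic_on UNIV"
    and A: "open A" "A \<noteq> {}" and eq: "\<And>z. z \<in> A \<Longrightarrow> F z = G z"
  shows "F = G"
proof
  fix z
  \<comment> \<open>\<open>F - G\<close> may fail to be nicely meromorphic, since poles of
    \<open>F\<close> and \<open>G\<close> can cancel, so its singularities are removed
    first.\<close>
  define D where "D = remove_sings (\<lambda>z. F z - G z)"
  have mero: "(\<lambda>z. F z - G z) meromorphic_on UNIV"
    using F G by (auto simp: nicely_meromorphic_on_def intro: meromorphic_intros)
  then have D: "D nicely_meromorphic_on UNIV"
    unfolding D_def by (rule remove_sings_nicely_meromorphic)
  have D0: "D w = 0" if "w \<in> A" for w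
  proof -
    have "eventually (\<lambda>w. F w - G w = 0) (at w)"
      using eventually_at_in_open'[OF A(1) that] by eventually_elim (simp add: eq)
    then show ?thesis
      unfolding D_def by (intro remove_sings_eqI tendsto_eventually)
  qed
  then have "D constant_on A"
    by (auto simp: constant_on_def)
  then have "D constant_on UNIV"
    by (rule constant_on_extend_nicely_meromorphic_on[OF D]) (use A in auto)
  with D0 A have D_zero: "D w = 0" for w
    by (auto simp: constant_on_def)
  \<comment> \<open>\<open>D = 0\<close> gives \<open>F = G\<close> only in a punctured
    neighbourhood of \<open>z\<close>. The values at \<open>z\<close> follow because
    \<open>remove_sings\<close> depends only on such a neighbourhood and fixes both
    functions.\<close>
  have "isolated_singularity_at (\<lambda>z. F z - G z) z"
    using mero by (meson UNIV_I meromorphic_on_isolated_singularity meromorphic_on_meromorphic_at)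
  then have "eventually (\<lambda>w. D w = F w - G w) (at z)"
    unfolding D_def by (rule eventually_remove_sings_eq_at)
  then have "eventually (\<lambda>w. F w = G w) (at z)"
    by eventually_elim (simp add: D_zero)
  then have "remove_sings F z = remove_sings G z"
    by (rule remove_sings_cong) simp
  then show "F z = G z"
    using F[THEN remove_sings_nicely_meromorphic_eq] G[THEN remove_sings_nicely_meromorphic_eq] by simp
qed

text \<open>Both functions equal the integral on a half-plane that is open and contains 0.\<close>

lemma is_I_continuation_unique:
  assumes "is_I_continuation n m F" "is_I_continuation n m G"
  shows "F = G"
  by (rule nicely_meromorphic_on_UNIV_unique[of F G "{s. Re s > -1}"])
    (use assms in \<open>auto simp: is_I_continuation_def open_halfspace_Re_gt intro: exI[of _ 0]\<close>)

text \<open>The first conjunct ensures that the \<open>THE\<close> in \<open>I_mero\<close> denotes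
  a continuation. Where a denominator vanishes, the value of \<open>R\<close> reflects the
  convention \<open>x / 0 = 0\<close>, so the equality of functions is with
  \<open>remove_sings R\<close>.\<close>

theorem proposition3p2:
  fixes n m :: nat
  assumes "even n" and "n > 2"
  defines "R \<equiv> (\<lambda>s::complex.
      pochhammer (of_nat n - 1) m / pochhammer (of_nat n + s) m *
      hypergeo [of_nat m, 1 - of_nat n / 2, of_nat n + s, s + 1]
               [of_nat m + of_nat n + s, of_nat n / 2 + s + 1, 2 - of_nat n] 1)"
  shows "is_I_continuation n m (I_mero n m) \<and>
    R meromorphic_on UNIV \<and>
    I_mero n m = remove_sings R \<and>
    (\<forall>s. pochhammer (of_nat n + s) m \<noteq> 0 \<and>
         pochhammer (of_nat m + of_nat n + s) (n div 2 - 1) \<noteq> 0 \<and>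
         pochhammer (of_nat n / 2 + s + 1) (n div 2 - 1) \<noteq> 0 \<longrightarrow>
         I_mero n m s = R s)"
proof -
  define q where "q = n div 2 - 1"
  have n: "n = 2 * q + 2"
    using assms(1,2) by (auto simp: q_def elim!: evenE)
  have par: "1 - of_nat n / 2 = (- of_nat q :: complex)" "of_nat n / 2 = (of_nat q + 1 :: complex)"
    "2 - of_nat n = (- 2 * of_nat q :: complex)" "of_nat n = (2 * of_nat q + 2 :: complex)"
    "of_nat n - 1 = (2 * of_nat q + 1 :: complex)"
    by (simp_all add: n add_divide_distrib)
  have R: "R s = pochhammer (2 * of_nat q + 1) m / pochhammer (2 * of_nat q + 2 + s) m *
    (\<Sum>l\<le>q. pochhammer (of_nat m) l * pochhammer (- of_nat q) l *
        pochhammer (2 * of_nat q + 2 + s) l * pochhammer (s + 1) l /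
      (pochhammer (of_nat m + 2 * of_nat q + 2 + s) l * pochhammer (of_nat q + 2 + s) l *
        pochhammer (- 2 * of_nat q) l * fact l))" for s
    unfolding R_def par(1,3,5) unfolding par(2) unfolding par(4)
    by (subst hypergeo_terminating[of q]) (simp_all add: mult_ac add_ac)
  have poch: "(\<lambda>s. pochhammer (a + s) l) analytic_on A" for a :: complex and l A
    by (rule analytic_on_subset[of _ UNIV])
       (auto simp: analytic_on_open intro!: holomorphic_intros)
  have poch': "(\<lambda>s. pochhammer (s + 1) l) analytic_on A" for l A
    using poch[of 1 l A] by (simp add: add.commute)
  note mero = poch[THEN analytic_on_imp_meromorphic_on] poch'[THEN analytic_on_imp_meromorphic_on]
  have R_mero: "R meromorphic_on UNIV"
    unfolding R[abs_def] by (intro meromorphic_intros mero)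
  have R_analytic: "R analytic_on {s}"
    if "pochhammer (of_nat n + s) m \<noteq> 0" "pochhammer (of_nat m + of_nat n + s) q \<noteq> 0"
       "pochhammer (of_nat n / 2 + s + 1) q \<noteq> 0" for s
  proof -
    \<comment> \<open>A symbol that is nonzero at length \<open>q\<close> is nonzero at each length
      \<open>l \<le> q\<close>, and \<open>pochhammer (- 2 * q) l\<close> vanishes only for
      \<open>l > 2 * q\<close>.\<close>
    have "pochhammer (of_nat m + 2 * of_nat q + 2 + s) l \<noteq> 0" "pochhammer (of_nat q + 2 + s) l \<noteq> 0"
      "pochhammer (- 2 * of_nat q :: complex) l \<noteq> 0" if "l \<le> q" for l
      using pochhammer_neq_0_mono[OF _ that] \<open>pochhammer (of_nat m + of_nat n + s) q \<noteq> 0\<close>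
        \<open>pochhammer (of_nat n / 2 + s + 1) q \<noteq> 0\<close> that
        pochhammer_of_nat_eq_0_iff[of "2 * q" l, where 'a = complex]
      unfolding par(2) by (auto simp: n add_ac)
    then show ?thesis
      using that(1) unfolding R[abs_def] par(4) by (intro analytic_intros poch poch') auto
  qed
  then have sings: "remove_sings R s = R s"
    if "pochhammer (of_nat n + s) m \<noteq> 0" "pochhammer (of_nat m + of_nat n + s) q \<noteq> 0"
       "pochhammer (of_nat n / 2 + s + 1) q \<noteq> 0" for s
    using that by simp
  have "remove_sings R s = I_integral n m s" if "Re s > -1" for s
  proof -
    \<comment> \<open>For \<open>Re s > -1\<close> the bases of all three symbols have positive real
      part, so \<open>R\<close> is analytic at \<open>s\<close>.\<close>
    have "remove_sings R s = R s"
      by (intro sings pochhammer_nonzero_Re) (use that \<open>n > 2\<close> in \<open>simp_all add: par(2)\<close>)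
    then show ?thesis
      using I_integral_eq[OF that] by (simp only: R n)
  qed
  with R_mero have cont: "is_I_continuation n m (remove_sings R)"
    by (simp add: is_I_continuation_def remove_sings_nicely_meromorphic)
  have "I_mero n m = remove_sings R"
    unfolding I_mero_def
    by (rule the_equality[of "is_I_continuation n m", OF cont is_I_continuation_unique[OF _ cont]])
  with cont R_mero sings show ?thesis
    by (simp add: q_def)
qed

end
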